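(* Let $H=(V,E)$ be a hypergraph with $|V|=n$, every edge having at least two vertices, with maximum edge size $k_{\max}$. Let $\lambda_2$ be the second smallest eigenvalue of the Laplacian $L$ of $H$, and define the isoperimetric number $\phi(H)=\min\left\{\frac{|\partial S|}{|S|}: S\subseteq V,\ S\neq\emptyset,\ |S|\le n/2\right\}$. Then $$\phi(H) \geq \frac{2\lambda_2}{k^2_{\max}} .$$
   Context: For $V=\{1,\dots,n\}$, the adjacency matrix $A=(a_{ij})$ has $a_{ii}=0$ and, for $i\ne j$, $a_{ij}$ equal to the number of edges containing both $i$ and $j$. The Laplacian degree is $\delta_i=\sum_j a_{ij}$ and the Laplacian is $L=\mathrm{diag}(\delta_1,\dots,\delta_n)-A$, with eigenvalues $\lambda_1\le\lambda_2\le\dots\le\lambda_n$. The edge boundary $\partial S$ is the set of edges $e\in E$ that intersect both $S$ and $V\setminus S$. *)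

theory Defs
  imports "Jordan_Normal_Form.Char_Poly"
begin

(* The vertices are numbered 0, ..., n-1 to match the matrix indices. *)
definition hypergraph :: "nat \<Rightarrow> nat set set \<Rightarrow> bool" where
  "hypergraph n E \<longleftrightarrow> (\<forall>e\<in>E. e \<subseteq> {0..<n})"

definition adjacency_matrix :: "nat \<Rightarrow> nat set set \<Rightarrow> real mat" where
  "adjacency_matrix n E =
     mat n n (\<lambda>(i, j). if i = j then 0 else real (card {e \<in> E. i \<in> e \<and> j \<in> e}))"

definition laplacian_degree :: "nat \<Rightarrow> nat set set \<Rightarrow> nat \<Rightarrow> real" where
  "laplacian_degree n E i = (\<Sum>j<n. adjacency_matrix n E $$ (i, j))"

definition laplacian :: "nat \<Rightarrow> nat set set \<Rightarrow> real mat" where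
  "laplacian n E = mat_diag n (laplacian_degree n E) - adjacency_matrix n E"

(* The real eigenvalues in increasing order, repeated according to algebraic
   multiplicity. List positions start at 0, so \<lambda>_i is found at position i - 1. *)
definition sorted_eigenvalues :: "real mat \<Rightarrow> real list" where
  "sorted_eigenvalues A = sorted_list_of_multiset (proots (char_poly A))"

definition second_smallest_eigenvalue :: "real mat \<Rightarrow> real" where
  "second_smallest_eigenvalue A = sorted_eigenvalues A ! 1"

(* Unspecified if there are no edges. *)
definition max_edge_size :: "nat set set \<Rightarrow> nat" where
  "max_edge_size E = Max (card ` E)"

definition edge_boundary :: "nat \<Rightarrow> nat set set \<Rightarrow> nat set \<Rightarrow> nat set set" where
  "edge_boundary n E S = {e \<in> E. e \<inter> S \<noteq> {} \<and> e \<inter> ({0..<n} - S) \<noteq> {}}"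

definition isoperimetric_number :: "nat \<Rightarrow> nat set set \<Rightarrow> real" where
  "isoperimetric_number n E =
     Min {real (card (edge_boundary n E S)) / real (card S) | S.
            S \<subseteq> {0..<n} \<and> S \<noteq> {} \<and> real (card S) \<le> real n / 2}"

end

theory Submission
  imports Defs
begin

text \<open>
  Let \<open>t = \<lambda>\<^sub>2\<close>. Deflating a symmetric matrix by an eigenvector of \<open>\<lambda>\<^sub>1\<close> shows that
  \<open>t * (x \<bullet> x) \<le> x \<bullet> (L *\<^sub>v x)\<close> on some hyperplane. If \<open>t > 0\<close>, a shift \<open>x = 1\<^sub>S - c\<close>
  of the indicator of \<open>S\<close> lies in that hyperplane. The quadratic form of \<open>L\<close> is half the sum
  of \<open>(x\<^sub>i - x\<^sub>j)\<^sup>2\<close> over all edges and all ordered pairs of vertices of the edge, so it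
  does not see \<open>c\<close>, and each boundary edge contributes
  \<open>|e \<inter> S| |e - S| \<le> k\<^sub>m\<^sub>a\<^sub>x\<^sup>2 / 4\<close>. On the other hand
  \<open>x \<bullet> x \<ge> |S| (n - |S|) / n \<ge> |S| / 2\<close> for every \<open>c\<close>.
\<close>

section \<open>Orthogonal deflation of a symmetric matrix\<close>

text \<open>Deflation needs an orthogonal matrix whose first column is a prescribed unit vector. A
  reflection supplies one that is its own transpose and its own inverse, so conjugation by
  \<open>H\<close> is at once a similarity and an orthogonal change of coordinates.\<close>

lemma householder_reflection:
  fixes v :: "real vec"
  assumes v: "v \<in> carrier_vec (Suc n)" and unit: "v \<bullet> v = 1"
  obtains H where "H \<in> carrier_mat (Suc n) (Suc n)" "H\<^sup>T = H" "H * H = 1\<^sub>m (Suc n)"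
    "H *\<^sub>v unit_vec (Suc n) 0 = v"
proof (cases "v = unit_vec (Suc n) 0")
  case True
  show ?thesis by (rule that[of "1\<^sub>m (Suc n)"]) (use True in auto)
next
  case False
  \<comment> \<open>Reflect in the hyperplane orthogonal to the difference of \<open>v\<close> and the unit vector.\<close>
  define u where "u i = v $ i - (if i = 0 then 1 else 0)" for i
  define s where "s = (\<Sum>i<Suc n. u i * u i)"
  have vv: "(\<Sum>i<Suc n. v $ i * v $ i) = 1"
    using v unit by (simp add: scalar_prod_def atLeast0LessThan)
  have "s = (\<Sum>i<Suc n. v $ i * v $ i) - (\<Sum>i<Suc n. if i = 0 then 2 * v $ 0 - 1 else 0)"
    unfolding s_def u_def sum_subtractf[symmetric] by (rule sum.cong) (auto simp: algebra_simps)
  hence s: "s = 2 - 2 * v $ 0" using vv by (simp add: sum.delta)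
  have "s \<noteq> 0"
  proof
    assume "s = 0"
    hence "\<forall>i<Suc n. u i = 0" unfolding s_def by (subst (asm) sum_nonneg_eq_0_iff) auto
    hence "v = unit_vec (Suc n) 0" using v by (intro eq_vecI) (auto simp: u_def)
    with False show False by simp
  qed
  define h where "h i j = (if i = j then 1 else 0) - 2 / s * u i * u j" for i j
  define H where "H = mat (Suc n) (Suc n) (\<lambda>(i, j). h i j)"
  have hh: "(\<Sum>k<Suc n. h i k * h k j) = (if i = j then 1 else 0)"
    if "i < Suc n" "j < Suc n" for i j
  proof -
    \<comment> \<open>Multiplying out separates the terms carrying a Kronecker delta from a multiple
      of \<open>u k * u k\<close>, which sums to a multiple of \<open>s\<close> and cancels the two
      mixed terms.\<close>
    have "(\<Sum>k<Suc n. h i k * h k j) =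
      (\<Sum>k<Suc n. (if k = i then (if i = j then 1 else 0) - 2 / s * u i * u j else 0)
        - (if k = j then 2 / s * u i * u j else 0) + (4 / s^2 * u i * u j) * (u k * u k))"
      by (rule sum.cong) (auto simp: h_def algebra_simps power2_eq_square)
    also have "\<dots> = (if i = j then 1 else 0) - 2 / s * u i * u j - 2 / s * u i * u j
        + (4 / s^2 * u i * u j) * s"
      unfolding sum.distrib sum_subtractf sum_distrib_left[symmetric] s_def[symmetric]
      using that by (simp add: sum.delta del: sum.lessThan_Suc)
    also have "\<dots> = (if i = j then 1 else 0)"
      using \<open>s \<noteq> 0\<close> by (simp add: power2_eq_square)
    finally show ?thesis .
  qed
  show ?thesis
  proof (rule that[of H])
    show "H \<in> carrier_mat (Suc n) (Suc n)" by (simp add: H_def)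
    show "H\<^sup>T = H" by (rule eq_matI) (auto simp: H_def h_def)
    show "H * H = 1\<^sub>m (Suc n)"
      by (rule eq_matI)
        (auto simp: H_def scalar_prod_def atLeast0LessThan hh simp del: sum.lessThan_Suc)
    show "H *\<^sub>v unit_vec (Suc n) 0 = v"
    proof (rule eq_vecI)
      fix i assume "i < dim_vec v"
      hence i: "i < Suc n" using v by auto
      have "(H *\<^sub>v unit_vec (Suc n) 0) $ i = h i 0"
        using i by (simp add: H_def)
      \<comment> \<open>Since \<open>u 0 = v $ 0 - 1 = - s / 2\<close>, the factor
        \<open>2 / s\<close> cancels, leaving \<open>u i\<close> plus the entry of the unit
        vector.\<close>
      also have "\<dots> = v $ i"
        using \<open>s \<noteq> 0\<close> by (simp add: h_def u_def s field_simps)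
      finally show "(H *\<^sub>v unit_vec (Suc n) 0) $ i = v $ i" .
    qed (use v in \<open>simp add: H_def\<close>)
  qed
qed

text \<open>In orthonormal coordinates starting with a unit eigenvector, the first column becomes
  \<open>e\<close> followed by zeros, and symmetry clears the first row too. The remaining block is
  symmetric again and carries the other roots, which permits induction on the dimension.\<close>

lemma symmetric_deflation:
  fixes A :: "real mat"
  assumes A: "A \<in> carrier_mat (Suc n) (Suc n)" and sym: "A\<^sup>T = A" and ev: "eigenvalue A e"
  obtains H B where "H \<in> carrier_mat (Suc n) (Suc n)" "H\<^sup>T = H" "H * H = 1\<^sub>m (Suc n)"
    "B \<in> carrier_mat n n" "B\<^sup>T = B"
    "H * A * H = four_block_mat (mat 1 1 (\<lambda>_. e)) (0\<^sub>m 1 n) (0\<^sub>m n 1) B"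
    "char_poly A = [:- e, 1:] * char_poly B"
proof -
  let ?N = "Suc n"
  let ?e0 = "unit_vec ?N 0 :: real vec"
  obtain w where w: "w \<in> carrier_vec ?N" "w \<noteq> 0\<^sub>v ?N" "A *\<^sub>v w = e \<cdot>\<^sub>v w"
    using ev A unfolding eigenvalue_def eigenvector_def by auto
  have "w \<bullet> w \<noteq> 0"
  proof
    assume "w \<bullet> w = 0"
    hence "\<forall>i<?N. w $ i = 0" using w(1) unfolding scalar_prod_def
      by (subst (asm) sum_nonneg_eq_0_iff) auto
    hence "w = 0\<^sub>v ?N" using w(1) by (intro eq_vecI) auto
    with w(2) show False by simp
  qed
  moreover have "w \<bullet> w \<ge> 0" unfolding scalar_prod_def by (simp add: sum_nonneg)
  ultimately have ww: "w \<bullet> w > 0" by simp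
  define v where "v = (1 / sqrt (w \<bullet> w)) \<cdot>\<^sub>v w"
  have v: "v \<in> carrier_vec ?N" using w by (simp add: v_def)
  have "v \<bullet> v = 1" using w ww by (simp add: v_def)
  then obtain H where H: "H \<in> carrier_mat ?N ?N" "H\<^sup>T = H" "H * H = 1\<^sub>m ?N" "H *\<^sub>v ?e0 = v"
    using householder_reflection[OF v] by metis
  have Av: "A *\<^sub>v v = e \<cdot>\<^sub>v v"
    using w A by (simp add: v_def mult_mat_vec smult_smult_assoc mult.commute)
  define C where "C = H * A * H"
  have C: "C \<in> carrier_mat ?N ?N" using H A by (simp add: C_def)
  have "C *\<^sub>v ?e0 = H *\<^sub>v (A *\<^sub>v v)"
    unfolding C_def using H A by (simp add: assoc_mult_mat_vec[of _ _ ?N _ ?N])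
  also have "\<dots> = e \<cdot>\<^sub>v (H *\<^sub>v (H *\<^sub>v ?e0))"
    using H v by (simp add: Av mult_mat_vec)
  also have "H *\<^sub>v (H *\<^sub>v ?e0) = (H * H) *\<^sub>v ?e0"
    by (rule assoc_mult_mat_vec[symmetric, OF H(1) H(1)]) simp
  also have "\<dots> = ?e0" unfolding H(3) by simp
  finally have Ce0: "C *\<^sub>v ?e0 = e \<cdot>\<^sub>v ?e0" .
  have col: "C $$ (i, 0) = (if i = 0 then e else 0)" if "i < ?N" for i
    using arg_cong[OF Ce0, of "\<lambda>x. x $ i"] that C by simp
  have symC: "C\<^sup>T = C"
    unfolding C_def using H A sym
    by (simp add: transpose_mult[of _ ?N ?N _ ?N] assoc_mult_mat[of _ ?N ?N _ ?N _ ?N])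
  have sC: "C $$ (i, j) = C $$ (j, i)" if "i < ?N" "j < ?N" for i j
    using arg_cong[OF symC, of "\<lambda>x. x $$ (j, i)"] that C by simp
  define B where "B = mat n n (\<lambda>(i, j). C $$ (Suc i, Suc j))"
  have B: "B \<in> carrier_mat n n" by (simp add: B_def)
  have symB: "B\<^sup>T = B" by (rule eq_matI) (auto simp: B_def sC)
  have block: "C = four_block_mat (mat 1 1 (\<lambda>_. e)) (0\<^sub>m 1 n) (0\<^sub>m n 1) B"
    using C B by (intro eq_matI) (auto simp: B_def col sC[of 0])
  have "similar_mat C A"
    by (rule similar_matI[of _ _ H H ?N]) (use H A C in \<open>auto simp: C_def\<close>)
  hence "char_poly A = char_poly C" by (simp add: char_poly_similar)
  also have "\<dots> = char_poly (mat 1 1 (\<lambda>_. e)) * char_poly B"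
    unfolding block by (rule char_poly_four_block_zeros_col) (use B in auto)
  also have "char_poly (mat 1 1 (\<lambda>_. e)) = [:- e, 1:]"
    by (simp add: char_poly_defs det_def sign_def)
  finally show ?thesis using that H B symB block unfolding C_def by blast
qed

text \<open>\<open>H\<close> preserves scalar products, so both forms can be evaluated at
  \<open>H *\<^sub>v x\<close>. The block shape decouples its first coordinate from the rest, and
  the rest is \<open>y\<close>.\<close>

lemma block_quadratic_form:
  fixes A H B :: "real mat"
  assumes A: "A \<in> carrier_mat (Suc n) (Suc n)"
    and H: "H \<in> carrier_mat (Suc n) (Suc n)" "H\<^sup>T = H" "H * H = 1\<^sub>m (Suc n)"
    and B: "B \<in> carrier_mat n n"
    and block: "H * A * H = four_block_mat (mat 1 1 (\<lambda>_. e)) (0\<^sub>m 1 n) (0\<^sub>m n 1) B"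
    and x: "x \<in> carrier_vec (Suc n)"
  obtains y where "y \<in> carrier_vec n"
    "x \<bullet> (A *\<^sub>v x) = e * ((H *\<^sub>v x) $ 0)\<^sup>2 + y \<bullet> (B *\<^sub>v y)"
    "x \<bullet> x = ((H *\<^sub>v x) $ 0)\<^sup>2 + y \<bullet> y"
proof -
  let ?N = "Suc n"
  define z where "z = H *\<^sub>v x"
  have z: "z \<in> carrier_vec ?N" using H x by (simp add: z_def)
  have Hz: "H *\<^sub>v z = x"
    unfolding z_def using H x by (simp add: assoc_mult_mat_vec[symmetric, of _ ?N ?N _ ?N])
  have adj: "(H *\<^sub>v p) \<bullet> q = p \<bullet> (H *\<^sub>v q)" if "p \<in> carrier_vec ?N" "q \<in> carrier_vec ?N" for p q
    using transpose_vec_mult_scalar[of H ?N ?N q p] H that by simp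
  define a where "a = vec_first z 1"
  define y where "y = vec_last z n"
  have ay: "z = a @\<^sub>v y" using z by (simp add: a_def y_def)
  have a: "a \<in> carrier_vec 1" and y: "y \<in> carrier_vec n" by (simp_all add: a_def y_def)
  have a0: "a $ 0 = z $ 0" by (simp add: a_def vec_first_def)
  have "x \<bullet> x = z \<bullet> z"
    using adj[of z x] z x by (simp add: Hz z_def[symmetric])
  also have "\<dots> = a \<bullet> a + y \<bullet> y"
    unfolding ay using a y by (rule scalar_prod_append[OF _ _ a y])
  also have "a \<bullet> a = (z $ 0)\<^sup>2"
    using a by (simp add: scalar_prod_def a0 power2_eq_square)
  finally have 1: "x \<bullet> x = (z $ 0)\<^sup>2 + y \<bullet> y" .
  have "x \<bullet> (A *\<^sub>v x) = z \<bullet> ((H * A * H) *\<^sub>v z)"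
    using adj[of z "A *\<^sub>v x"] z x A H Hz by (simp add: assoc_mult_mat_vec[of _ ?N ?N _ ?N])
  also have "(H * A * H) *\<^sub>v z = (mat 1 1 (\<lambda>_. e) *\<^sub>v a) @\<^sub>v (B *\<^sub>v y)"
    unfolding block ay using a y B
    by (intro mult_mat_vec_split) auto
  also have "z \<bullet> \<dots> = a \<bullet> (mat 1 1 (\<lambda>_. e) *\<^sub>v a) + y \<bullet> (B *\<^sub>v y)"
    unfolding ay
    by (rule scalar_prod_append[OF a y mult_mat_vec_carrier[OF mat_carrier a] mult_mat_vec_carrier[OF B y]])
  also have "a \<bullet> (mat 1 1 (\<lambda>_. e) *\<^sub>v a) = e * (z $ 0)\<^sup>2"
    using a by (simp add: scalar_prod_def a0 power2_eq_square)
  finally show ?thesis using that[OF y] 1 unfolding z_def by blast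
qed

section \<open>Rayleigh quotients\<close>

text \<open>Induction on the list of roots: each deflation splits off a square with weight
  \<open>e \<ge> t\<close> and leaves a smaller symmetric matrix with the remaining roots.\<close>

lemma rayleigh_ge_smallest_eigenvalue:
  fixes A :: "real mat"
  assumes "A \<in> carrier_mat n n" "A\<^sup>T = A" "char_poly A = (\<Prod>e\<leftarrow>es. [:- e, 1:])"
    and "\<forall>e\<in>set es. t \<le> e" "x \<in> carrier_vec n"
  shows "t * (x \<bullet> x) \<le> x \<bullet> (A *\<^sub>v x)"
  using assms
proof (induction es arbitrary: n A x)
  case Nil
  \<comment> \<open>The degree of the characteristic polynomial is the dimension, so an empty list
    of roots leaves only empty sums.\<close>
  hence "n = 0" using degree_monic_char_poly[of A n] by simp
  with Nil show ?case by (simp add: scalar_prod_def)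
next
  case (Cons e es)
  have ev: "eigenvalue A e"
    using Cons.prems by (simp add: eigenvalue_root_char_poly)
  obtain m where n: "n = Suc m"
    using eigenvalue_imp_nonzero_dim[OF Cons.prems(1) ev] by (cases n) auto
  note prems = Cons.prems[unfolded n]
  obtain H B where H: "H \<in> carrier_mat (Suc m) (Suc m)" "H\<^sup>T = H" "H * H = 1\<^sub>m (Suc m)"
    and B: "B \<in> carrier_mat m m" "B\<^sup>T = B"
    and block: "H * A * H = four_block_mat (mat 1 1 (\<lambda>_. e)) (0\<^sub>m 1 m) (0\<^sub>m m 1) B"
    and cp: "char_poly A = [:- e, 1:] * char_poly B"
    using symmetric_deflation[OF prems(1,2) ev] by metis
  have "[:- e, 1:] * char_poly B = [:- e, 1:] * (\<Prod>e\<leftarrow>es. [:- e, 1:])"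
    using cp prems(3) by simp
  hence cpB: "char_poly B = (\<Prod>e\<leftarrow>es. [:- e, 1:])"
    by (metis mult_cancel_left pCons_eq_0_iff zero_neq_one)
  obtain y where y: "y \<in> carrier_vec m"
    "x \<bullet> (A *\<^sub>v x) = e * ((H *\<^sub>v x) $ 0)\<^sup>2 + y \<bullet> (B *\<^sub>v y)"
    "x \<bullet> x = ((H *\<^sub>v x) $ 0)\<^sup>2 + y \<bullet> y"
    using block_quadratic_form[OF prems(1) H B(1) block prems(5)] by metis
  have "t * (y \<bullet> y) \<le> y \<bullet> (B *\<^sub>v y)"
    using Cons.IH[OF B cpB _ y(1)] prems(4) by simp
  moreover have "t * ((H *\<^sub>v x) $ 0)\<^sup>2 \<le> e * ((H *\<^sub>v x) $ 0)\<^sup>2"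
    using prems(4) by (intro mult_right_mono) auto
  ultimately show ?case by (simp add: y(2,3) algebra_simps)
qed

text \<open>One inequality of the Courant-Fischer principle: on vectors without a component along
  the eigenvector split off, only the roots in \<open>es\<close> are felt.\<close>

lemma rayleigh_ge_on_hyperplane:
  fixes A :: "real mat"
  assumes A: "A \<in> carrier_mat n n" "A\<^sup>T = A"
    and cp: "char_poly A = (\<Prod>e\<leftarrow>e # es. [:- e, 1:])" and t: "\<forall>e\<in>set es. t \<le> e"
  obtains v where "v \<in> carrier_vec n"
    "\<And>x. x \<in> carrier_vec n \<Longrightarrow> v \<bullet> x = 0 \<Longrightarrow> t * (x \<bullet> x) \<le> x \<bullet> (A *\<^sub>v x)"
proof -
  have ev: "eigenvalue A e"
    using A cp by (simp add: eigenvalue_root_char_poly)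
  obtain m where n: "n = Suc m"
    using eigenvalue_imp_nonzero_dim[OF A(1) ev] by (cases n) auto
  note A = A[unfolded n]
  obtain H B where H: "H \<in> carrier_mat (Suc m) (Suc m)" "H\<^sup>T = H" "H * H = 1\<^sub>m (Suc m)"
    and B: "B \<in> carrier_mat m m" "B\<^sup>T = B"
    and block: "H * A * H = four_block_mat (mat 1 1 (\<lambda>_. e)) (0\<^sub>m 1 m) (0\<^sub>m m 1) B"
    and cpA: "char_poly A = [:- e, 1:] * char_poly B"
    using symmetric_deflation[OF A ev] by metis
  have "[:- e, 1:] * char_poly B = [:- e, 1:] * (\<Prod>e\<leftarrow>es. [:- e, 1:])"
    using cp cpA by simp
  hence cpB: "char_poly B = (\<Prod>e\<leftarrow>es. [:- e, 1:])"
    by (metis mult_cancel_left pCons_eq_0_iff zero_neq_one)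
  show ?thesis
  \<comment> \<open>By symmetry of \<open>H\<close> this row is also its first column, an
    eigenvector for \<open>e\<close>. Orthogonality to it is the vanishing of
    \<open>(H *\<^sub>v x) $ 0\<close>.\<close>
  proof (rule that[of "row H 0"])
    show "row H 0 \<in> carrier_vec n" using H(1) n by (intro carrier_vecI) auto
    fix x assume x: "x \<in> carrier_vec n" "row H 0 \<bullet> x = 0"
    have 0: "(H *\<^sub>v x) $ 0 = 0" using H x by simp
    obtain y where y: "y \<in> carrier_vec m"
      "x \<bullet> (A *\<^sub>v x) = e * ((H *\<^sub>v x) $ 0)\<^sup>2 + y \<bullet> (B *\<^sub>v y)"
      "x \<bullet> x = ((H *\<^sub>v x) $ 0)\<^sup>2 + y \<bullet> y"
      using block_quadratic_form[OF A(1) H B(1) block x(1)[unfolded n]] by metis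
    show "t * (x \<bullet> x) \<le> x \<bullet> (A *\<^sub>v x)"
      using rayleigh_ge_smallest_eigenvalue[OF B cpB t y(1)] unfolding y(2,3) 0 by simp
  qed
qed

section \<open>Real spectrum of symmetric matrices\<close>

text \<open>The Hermitian form of \<open>A\<close> at an eigenvector, called \<open>s\<close> below,
  is \<open>k\<close> times the squared norm. Symmetry of \<open>A\<close> and an exchange of the
  summation indices show that \<open>s\<close> is its own conjugate.\<close>

lemma symmetric_complex_eigenvalue_real:
  fixes A :: "real mat"
  assumes A: "A \<in> carrier_mat n n" and sym: "A\<^sup>T = A"
    and ev: "eigenvalue (map_mat complex_of_real A) k"
  shows "k \<in> \<real>"
proof -
  obtain v where v: "v \<in> carrier_vec n" "v \<noteq> 0\<^sub>v n" "map_mat complex_of_real A *\<^sub>v v = k \<cdot>\<^sub>v v"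
    using ev A unfolding eigenvalue_def eigenvector_def by auto
  have sA: "A $$ (i, j) = A $$ (j, i)" if "i < n" "j < n" for i j
    using arg_cong[OF sym, of "\<lambda>x. x $$ (j, i)"] that A by simp
  have kv: "(\<Sum>j<n. of_real (A $$ (i, j)) * v $ j) = k * v $ i" if "i < n" for i
    using arg_cong[OF v(3), of "\<lambda>x. x $ i"] that A v(1)
    by (simp add: scalar_prod_def atLeast0LessThan)
  define s where "s = (\<Sum>i<n. \<Sum>j<n. cnj (v $ i) * (of_real (A $$ (i, j)) * v $ j))"
  define r where "r = (\<Sum>i<n. (cmod (v $ i))\<^sup>2)"
  have "s = (\<Sum>i<n. cnj (v $ i) * (k * v $ i))"
    unfolding s_def by (intro sum.cong refl) (simp add: sum_distrib_left[symmetric] kv)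
  also have "\<dots> = k * of_real r"
    unfolding r_def of_real_sum sum_distrib_left complex_norm_square
    by (intro sum.cong refl) (simp add: mult_ac)
  finally have "s = k * of_real r" .
  have "cnj s = (\<Sum>i<n. \<Sum>j<n. cnj (v $ j) * (of_real (A $$ (j, i)) * v $ i))"
    unfolding s_def cnj_sum by (intro sum.cong refl) (simp add: sA mult_ac)
  also have "\<dots> = s" unfolding s_def by (rule sum.swap)
  finally have "s \<in> \<real>" by (simp add: Reals_cnj_iff)
  have "r \<noteq> 0"
  proof
    assume "r = 0"
    hence "\<forall>i<n. v $ i = 0" unfolding r_def by (subst (asm) sum_nonneg_eq_0_iff) auto
    hence "v = 0\<^sub>v n" using v(1) by (intro eq_vecI) auto
    with v(2) show False by simp
  qed
  hence "k = s / of_real r" using \<open>s = k * of_real r\<close> by simp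
  thus ?thesis using \<open>s \<in> \<real>\<close> by (simp add: Reals_divide)
qed

text \<open>\<open>sorted_eigenvalues\<close> lists real roots only, so in general it may be shorter
  than the dimension. Here the complex factorization has only real roots and descends to the reals.
  The length ensures that position 1 exists once \<open>n \<ge> 2\<close>.\<close>

lemma symmetric_char_poly_splits:
  fixes A :: "real mat"
  assumes A: "A \<in> carrier_mat n n" and sym: "A\<^sup>T = A"
  shows "char_poly A = (\<Prod>e\<leftarrow>sorted_eigenvalues A. [:- e, 1:])"
    "length (sorted_eigenvalues A) = n"
proof -
  let ?C = "map_mat complex_of_real A"
  have C: "?C \<in> carrier_mat n n" using A by simp
  obtain as where as: "char_poly ?C = (\<Prod>a\<leftarrow>as. [:- a, 1:])" "length as = n"
    using char_poly_factorized[OF C] by auto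
  have real: "a \<in> \<real>" if "a \<in> set as" for a
  proof -
    have "poly (char_poly ?C) a = 0"
      unfolding as(1) poly_prod_list using that by (simp add: prod_list_zero_iff image_iff)
    thus ?thesis
      using symmetric_complex_eigenvalue_real[OF A sym] eigenvalue_root_char_poly[OF C] by blast
  qed
  define rs where "rs = map Re as"
  have as_rs: "as = map complex_of_real rs"
    unfolding rs_def using real by (auto intro!: nth_equalityI)
  interpret hom: map_poly_inj_comm_ring_hom complex_of_real ..
  \<comment> \<open>Both sides are brought into the image of the coefficient embedding, whose
    injectivity then gives \<open>cp\<close>.\<close>
  have "map_poly complex_of_real (char_poly A) = (\<Prod>a\<leftarrow>as. [:- a, 1:])"
    unfolding as(1)[symmetric] by (rule of_real_hom.char_poly_hom[OF A, symmetric])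
  also have "\<dots> = map_poly complex_of_real (\<Prod>r\<leftarrow>rs. [:- r, 1:])"
    unfolding as_rs by (induction rs) (simp_all add: hom.hom_mult del: mult_pCons_left)
  finally have cp: "char_poly A = (\<Prod>r\<leftarrow>rs. [:- r, 1:])" by simp
  have nz: "(\<Prod>r\<leftarrow>us. [:- r, 1:]) \<noteq> 0" for us :: "real list"
    by (auto simp: prod_list_zero_iff)
  have "proots (\<Prod>r\<leftarrow>rs. [:- r, 1:]) = mset rs"
  proof (induction rs)
    case (Cons r rs)
    have "proots ([:- r, 1:] * (\<Prod>r\<leftarrow>rs. [:- r, 1:])) = add_mset r (mset rs)"
      by (subst proots_mult[OF _ nz]) (simp_all add: Cons.IH)
    thus ?case by simp
  qed simp
  hence sorted: "sorted_eigenvalues A = sort rs"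
    by (simp add: sorted_eigenvalues_def cp)
  have "mset (map (\<lambda>r. [:- r, 1:]) (sort rs)) = mset (map (\<lambda>r. [:- r, 1:]) rs)" by simp
  hence "(\<Prod>r\<leftarrow>sort rs. [:- r, 1:]) = (\<Prod>r\<leftarrow>rs. [:- r, 1:])"
    by (metis prod_mset_prod_list)
  thus "char_poly A = (\<Prod>e\<leftarrow>sorted_eigenvalues A. [:- e, 1:])" by (simp add: cp sorted)
  show "length (sorted_eigenvalues A) = n" by (simp add: sorted rs_def as(2))
qed

section \<open>The quadratic form of the Laplacian\<close>

lemma hypergraph_finite:
  assumes "hypergraph n E"
  shows "finite E" "e \<in> E \<Longrightarrow> e \<subseteq> {..<n}" "e \<in> E \<Longrightarrow> finite e"
proof -
  have sub: "e \<subseteq> {..<n}" if "e \<in> E" for e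
    using assms that by (simp add: hypergraph_def atLeast0LessThan)
  thus "e \<in> E \<Longrightarrow> e \<subseteq> {..<n}" "e \<in> E \<Longrightarrow> finite e"
    by (auto intro: finite_subset)
  have "E \<subseteq> Pow {..<n}" using sub by blast
  thus "finite E" by (rule finite_subset) simp
qed

lemma laplacian_carrier: "laplacian n E \<in> carrier_mat n n"
  by (auto simp: laplacian_def adjacency_matrix_def intro!: minus_carrier_mat)

lemma laplacian_symmetric: "(laplacian n E)\<^sup>T = laplacian n E"
  by (rule eq_matI) (auto simp: laplacian_def adjacency_matrix_def mat_diag_def conj_commute)

lemma laplacian_quadratic_form:
  assumes "hypergraph n E" and x: "x \<in> carrier_vec n"
  shows "x \<bullet> (laplacian n E *\<^sub>v x) = (\<Sum>e\<in>E. \<Sum>i\<in>e. \<Sum>j\<in>e. (x $ i - x $ j)\<^sup>2) / 2"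
proof -
  note fin = hypergraph_finite[OF assms(1)]
  define a where "a i j = adjacency_matrix n E $$ (i, j)" for i j
  have a: "a i j = (if i = j then 0 else real (card {e \<in> E. i \<in> e \<and> j \<in> e}))"
    if "i < n" "j < n" for i j
    using that by (simp add: a_def adjacency_matrix_def)
  have a_sym: "a i j = a j i" if "i < n" "j < n" for i j
    using that by (simp add: a conj_commute)
  have L: "laplacian n E $$ (i, j) = (if j = i then \<Sum>k<n. a i k else 0) - a i j"
    if "i < n" "j < n" for i j
    using that by (auto simp: laplacian_def mat_diag_def laplacian_degree_def a_def adjacency_matrix_def)
  \<comment> \<open>The diagonal entry is a row sum of \<open>a\<close>, so it can be distributed
    over the entries of that row.\<close>
  have Lx: "(laplacian n E *\<^sub>v x) $ i = (\<Sum>j<n. a i j * (x $ i - x $ j))" if "i < n" for i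
  proof -
    have "(laplacian n E *\<^sub>v x) $ i = (\<Sum>j<n. laplacian n E $$ (i, j) * x $ j)"
      using that x laplacian_carrier[of n E] by (simp add: scalar_prod_def atLeast0LessThan)
    also have "\<dots> = (\<Sum>j<n. (if j = i then (\<Sum>k<n. a i k) * x $ i else 0) - a i j * x $ j)"
      using that by (intro sum.cong) (auto simp: L algebra_simps)
    also have "\<dots> = (\<Sum>j<n. a i j * (x $ i - x $ j))"
      using that by (simp add: sum_subtractf sum_distrib_right right_diff_distrib)
    finally show ?thesis .
  qed
  define Q where "Q = x \<bullet> (laplacian n E *\<^sub>v x)"
  have Q: "Q = (\<Sum>i<n. \<Sum>j<n. a i j * (x $ i * (x $ i - x $ j)))"
    unfolding Q_def scalar_prod_def using laplacian_carrier[of n E]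
    by (auto simp: Lx atLeast0LessThan sum_distrib_left mult_ac simp del: index_mult_mat_vec intro!: sum.cong)
  also have "\<dots> = (\<Sum>j<n. \<Sum>i<n. a i j * (x $ i * (x $ i - x $ j)))" by (rule sum.swap)
  also have "\<dots> = (\<Sum>i<n. \<Sum>j<n. a i j * (x $ j * (x $ j - x $ i)))"
    by (intro sum.cong refl) (simp add: a_sym)
  \<comment> \<open>Symmetrization: the two expressions for \<open>Q\<close> differ by exchanging
    \<open>i\<close> and \<open>j\<close>, and their sum assembles the squares.\<close>
  finally have "Q + Q = (\<Sum>i<n. \<Sum>j<n. a i j * (x $ i * (x $ i - x $ j)))
      + (\<Sum>i<n. \<Sum>j<n. a i j * (x $ j * (x $ j - x $ i)))"
    using Q by simp
  hence "2 * Q = (\<Sum>i<n. \<Sum>j<n. a i j * (x $ i * (x $ i - x $ j)) + a i j * (x $ j * (x $ j - x $ i)))"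
    by (simp only: sum.distrib mult_2)
  also have "\<dots> = (\<Sum>i<n. \<Sum>j<n. a i j * (x $ i - x $ j)\<^sup>2)"
    by (intro sum.cong refl) (simp add: algebra_simps power2_eq_square)
  \<comment> \<open>Each \<open>a i j\<close> counts edges and so unfolds into a sum over
    \<open>E\<close>. On the diagonal \<open>a\<close> is 0, which agrees because the square
    vanishes there.\<close>
  also have "\<dots> = (\<Sum>i<n. \<Sum>j<n. \<Sum>e\<in>E. if i \<in> e \<and> j \<in> e then (x $ i - x $ j)\<^sup>2 else 0)"
    by (intro sum.cong refl)
      (auto simp: a sum.inter_filter[symmetric] fin(1))
  also have "\<dots> = (\<Sum>i<n. \<Sum>e\<in>E. \<Sum>j<n. if i \<in> e \<and> j \<in> e then (x $ i - x $ j)\<^sup>2 else 0)"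
    by (intro sum.cong refl) (rule sum.swap)
  also have "\<dots> = (\<Sum>e\<in>E. \<Sum>i<n. \<Sum>j<n. if i \<in> e \<and> j \<in> e then (x $ i - x $ j)\<^sup>2 else 0)"
    by (rule sum.swap)
  also have "\<dots> = (\<Sum>e\<in>E. \<Sum>i\<in>e. \<Sum>j\<in>e. (x $ i - x $ j)\<^sup>2)"
  proof (rule sum.cong)
    fix e assume e: "e \<in> E"
    have "(\<Sum>i<n. \<Sum>j<n. if i \<in> e \<and> j \<in> e then (x $ i - x $ j)\<^sup>2 else 0)
      = (\<Sum>i\<in>e. \<Sum>j<n. if i \<in> e \<and> j \<in> e then (x $ i - x $ j)\<^sup>2 else 0)"
      by (rule sum.mono_neutral_right) (use fin(2)[OF e] in auto)
    also have "\<dots> = (\<Sum>i\<in>e. \<Sum>j\<in>e. (x $ i - x $ j)\<^sup>2)"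
      by (intro sum.cong refl sum.mono_neutral_cong_right) (use fin(2)[OF e] in auto)
    finally show "(\<Sum>i<n. \<Sum>j<n. if i \<in> e \<and> j \<in> e then (x $ i - x $ j)\<^sup>2 else 0)
      = (\<Sum>i\<in>e. \<Sum>j\<in>e. (x $ i - x $ j)\<^sup>2)" .
  qed simp
  finally show ?thesis by (simp add: Q_def)
qed

section \<open>Cuts and the edge boundary\<close>

text \<open>Only pairs separated by \<open>S\<close> contribute, each of them 1; the factor 2 counts
  both orders.\<close>

lemma sum_indicator_differences:
  assumes "finite e"
  shows "(\<Sum>i\<in>e. \<Sum>j\<in>e. (of_bool (i \<in> S) - of_bool (j \<in> S))\<^sup>2)
    = 2 * real (card (e \<inter> S)) * (real (card e) - real (card (e \<inter> S)))"
proof -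
  have p: "(\<Sum>i\<in>e. of_bool (i \<in> S)) = real (card (e \<inter> S))"
    using assms by (simp add: Int_def)
  \<comment> \<open>For values 0 and 1, \<open>(a - b)\<^sup>2 = a + b - 2 * a * b\<close>, and in
    this form the double sum factors.\<close>
  have "(\<Sum>i\<in>e. \<Sum>j\<in>e. (of_bool (i \<in> S) - of_bool (j \<in> S))\<^sup>2)
    = (\<Sum>i\<in>e. \<Sum>j\<in>e. of_bool (i \<in> S) + of_bool (j \<in> S) - 2 * of_bool (i \<in> S) * of_bool (j \<in> S) :: real)"
    by (intro sum.cong refl) auto
  also have "\<dots> = 2 * real (card (e \<inter> S)) * (real (card e) - real (card (e \<inter> S)))"
    unfolding sum.distrib sum_subtractf sum_distrib_left[symmetric] sum_distrib_right[symmetric] p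
    by (simp add: sum_distrib_left[symmetric] sum_distrib_right[symmetric] p algebra_simps)
  finally show ?thesis .
qed

lemma cut_form_le_edge_boundary:
  assumes "hypergraph n E"
  shows "(\<Sum>e\<in>E. \<Sum>i\<in>e. \<Sum>j\<in>e. (of_bool (i \<in> S) - of_bool (j \<in> S))\<^sup>2)
    \<le> real (card (edge_boundary n E S)) * ((real (max_edge_size E))\<^sup>2 / 2)"
proof -
  note fin = hypergraph_finite[OF assms]
  let ?k = "real (max_edge_size E)"
  have edge: "(\<Sum>i\<in>e. \<Sum>j\<in>e. (of_bool (i \<in> S) - of_bool (j \<in> S))\<^sup>2)
    \<le> (if e \<in> edge_boundary n E S then ?k\<^sup>2 / 2 else 0)" if e: "e \<in> E" for e
  proof (cases "e \<in> edge_boundary n E S")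
    case True
    have "card e \<le> max_edge_size E" unfolding max_edge_size_def using fin(1) e by simp
    hence "(real (card e))\<^sup>2 \<le> ?k\<^sup>2" by (intro power_mono) auto
    \<comment> \<open>The arithmetic-geometric mean inequality for the two parts \<open>p\<close>
      and \<open>m - p\<close> of an edge.\<close>
    moreover have "2 * p * (m - p) \<le> m\<^sup>2 / 2" for p m :: real
      using zero_le_power2[of "m - 2 * p"] by (simp add: power2_eq_square algebra_simps)
    ultimately have "2 * real (card (e \<inter> S)) * (real (card e) - real (card (e \<inter> S))) \<le> ?k\<^sup>2 / 2"
      by (smt (verit) divide_right_mono)
    with True show ?thesis by (simp only: sum_indicator_differences[OF fin(3)[OF e]] if_True)
  next
    case False
    hence "e \<inter> S = {} \<or> e \<inter> S = e"
      using e fin(2)[OF e] by (fastforce simp: edge_boundary_def)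
    with False show ?thesis by (auto simp: sum_indicator_differences[OF fin(3)[OF e]])
  qed
  have "(\<Sum>e\<in>E. \<Sum>i\<in>e. \<Sum>j\<in>e. (of_bool (i \<in> S) - of_bool (j \<in> S))\<^sup>2)
    \<le> (\<Sum>e\<in>E. if e \<in> edge_boundary n E S then ?k\<^sup>2 / 2 else 0)"
    by (rule sum_mono) (rule edge)
  also have "\<dots> = (\<Sum>e\<in>edge_boundary n E S. ?k\<^sup>2 / 2)"
    by (rule sum.mono_neutral_cong_right) (auto simp: edge_boundary_def fin(1))
  finally show ?thesis by simp
qed

text \<open>The bound for a single \<open>S\<close>, with denominators cleared. Positivity of the
  eigenvalue keeps nonzero constant vectors out of the hyperplane, so a constant shift can move the
  indicator of \<open>S\<close> into it.\<close>

lemma second_eigenvalue_cut_bound: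
  assumes n: "n \<ge> 2" and hyp: "hypergraph n E"
    and S: "S \<subseteq> {0..<n}" "real (card S) \<le> real n / 2"
    and pos: "second_smallest_eigenvalue (laplacian n E) > 0"
  shows "2 * second_smallest_eigenvalue (laplacian n E) * real (card S)
    \<le> real (card (edge_boundary n E S)) * (real (max_edge_size E))\<^sup>2"
proof -
  let ?L = "laplacian n E"
  define t where "t = second_smallest_eigenvalue ?L"
  have t: "t > 0" using pos by (simp add: t_def)
  note L = laplacian_carrier[of n E] laplacian_symmetric[of n E]
  note splits = symmetric_char_poly_splits[OF L]
  obtain e es where es: "sorted_eigenvalues ?L = e # t # es"
    using splits(2) n unfolding t_def second_smallest_eigenvalue_def
    by (cases "sorted_eigenvalues ?L"; cases "tl (sorted_eigenvalues ?L)") auto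
  have "sorted (sorted_eigenvalues ?L)" by (simp add: sorted_eigenvalues_def)
  hence "\<forall>e\<in>set (t # es). t \<le> e" by (simp add: es)
  then obtain v where v: "v \<in> carrier_vec n"
    and ge: "\<And>x. x \<in> carrier_vec n \<Longrightarrow> v \<bullet> x = 0 \<Longrightarrow> t * (x \<bullet> x) \<le> x \<bullet> (?L *\<^sub>v x)"
    using rayleigh_ge_on_hyperplane[OF L splits(1)[unfolded es]] by metis
  define p where "p = (\<Sum>i<n. v $ i)"
  define q where "q = (\<Sum>i<n. v $ i * of_bool (i \<in> S))"
  \<comment> \<open>Otherwise the all-ones vector, on which the form vanishes, lies in the hyperplane.\<close>
  have "p \<noteq> 0" if "q \<noteq> 0"
  proof
    assume "p = 0"
    define u where "u = vec n (\<lambda>i. 1 :: real)"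
    have u: "u \<in> carrier_vec n" by (simp add: u_def)
    have "v \<bullet> u = 0" using \<open>p = 0\<close> by (simp add: u_def p_def scalar_prod_def atLeast0LessThan)
    hence "t * (u \<bullet> u) \<le> u \<bullet> (?L *\<^sub>v u)" by (rule ge[OF u])
    also have "\<dots> = 0"
      using hypergraph_finite(2)[OF hyp] unfolding laplacian_quadratic_form[OF hyp u]
      by (auto simp: u_def subset_eq intro!: sum.neutral)
    finally show False using t n by (simp add: u_def scalar_prod_def mult_le_0_iff)
  qed
  \<comment> \<open>The shift making \<open>x\<close> orthogonal to \<open>v\<close>:
    \<open>c = q / p\<close>, or \<open>c = 0\<close> when \<open>q = 0\<close>.\<close>
  then obtain c where c: "q = c * p" by (metis mult_zero_left nonzero_eq_divide_eq)
  define x where "x = vec n (\<lambda>i. of_bool (i \<in> S) - c)"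
  have x: "x \<in> carrier_vec n" by (simp add: x_def)
  have "v \<bullet> x = q - c * p"
    unfolding p_def q_def sum_distrib_left sum_subtractf[symmetric] scalar_prod_def
    by (auto simp: x_def atLeast0LessThan algebra_simps intro!: sum.cong)
  hence "t * (x \<bullet> x) \<le> x \<bullet> (?L *\<^sub>v x)" using c by (intro ge[OF x]) simp
  also have "\<dots> = (\<Sum>e\<in>E. \<Sum>i\<in>e. \<Sum>j\<in>e. (of_bool (i \<in> S) - of_bool (j \<in> S))\<^sup>2) / 2"
    unfolding laplacian_quadratic_form[OF hyp x]
    using hypergraph_finite(2)[OF hyp]
    by (intro arg_cong[of _ _ "\<lambda>z. z / 2"] sum.cong refl) (auto simp: x_def subset_eq)
  also have "\<dots> \<le> real (card (edge_boundary n E S)) * (real (max_edge_size E))\<^sup>2 / 4"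
    using cut_form_le_edge_boundary[OF hyp, of S] by simp
  finally have upper: "t * (x \<bullet> x) \<le> real (card (edge_boundary n E S)) * (real (max_edge_size E))\<^sup>2 / 4" .
  define m where "m = real (card S)"
  have "{..<n} \<inter> {i. i \<in> S} = S" using S(1) by auto
  hence ind: "(\<Sum>i<n. of_bool (i \<in> S)) = m" by (simp add: m_def)
  have "x \<bullet> x = (\<Sum>i<n. (1 - 2 * c) * of_bool (i \<in> S) + c\<^sup>2)"
    by (auto simp: x_def scalar_prod_def atLeast0LessThan power2_eq_square algebra_simps intro!: sum.cong)
  also have "\<dots> = (1 - 2 * c) * m + real n * c\<^sup>2"
    by (simp add: sum.distrib sum_distrib_left[symmetric] ind del: sum_of_bool_eq sum_mult_of_bool_eq)
  finally have xx: "x \<bullet> x = (1 - 2 * c) * m + real n * c\<^sup>2" .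
  \<comment> \<open>Completing the square in \<open>c\<close>: the worst shift is the mean
    \<open>m / n\<close> of the indicator, and \<open>m \<le> n / 2\<close> bounds what
    remains.\<close>
  have "real n * (x \<bullet> x) = (c * real n - m)\<^sup>2 + m * (real n - m)"
    unfolding xx by (simp add: power2_eq_square algebra_simps)
  also have "\<dots> \<ge> 0 + m * (real n / 2)"
    using S(2) by (intro add_mono mult_left_mono) (auto simp: m_def)
  finally have "real n * (m / 2) \<le> real n * (x \<bullet> x)" by (simp add: algebra_simps)
  hence "m / 2 \<le> x \<bullet> x" using n by simp
  hence "t * (m / 2) \<le> t * (x \<bullet> x)" using t by simp
  with upper show ?thesis unfolding t_def[symmetric] m_def[symmetric] by simp
qed

section \<open>Minimum over all admissible sets\<close>

theorem theorem3p4: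
  fixes n :: nat and E :: "nat set set"
  assumes "n \<ge> 2"
    and "hypergraph n E"
    and "\<forall>e\<in>E. card e \<ge> 2"
  shows "isoperimetric_number n E
           \<ge> 2 * second_smallest_eigenvalue (laplacian n E) / (real (max_edge_size E))\<^sup>2"
proof -
  let ?t = "second_smallest_eigenvalue (laplacian n E)"
  let ?k = "real (max_edge_size E)"
  let ?sets = "{S. S \<subseteq> {0..<n} \<and> S \<noteq> {} \<and> real (card S) \<le> real n / 2}"
  let ?ratio = "\<lambda>S. real (card (edge_boundary n E S)) / real (card S)"
  have fin: "finite ?sets" by (rule finite_subset[of _ "Pow {0..<n}"]) auto
  \<comment> \<open>A singleton is admissible because \<open>n \<ge> 2\<close>, so the minimum is
    over a nonempty set.\<close>
  have "{0} \<in> ?sets" using assms(1) by auto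
  hence ne: "?sets \<noteq> {}" by blast
  have ratio: "2 * ?t / ?k\<^sup>2 \<le> ?ratio S" if S: "S \<in> ?sets" for S
  \<comment> \<open>If \<open>?t \<le> 0\<close>, or if \<open>?k = 0\<close> and the quotient is 0
    by convention, the left side is at most 0 and the ratio is nonnegative. Otherwise the cut bound
    can be divided by positive numbers.\<close>
  proof (cases "?t > 0 \<and> ?k > 0")
    case True
    have "card S > 0" using S by (auto simp: card_gt_0_iff intro: finite_subset)
    moreover have "2 * ?t * real (card S) \<le> real (card (edge_boundary n E S)) * ?k\<^sup>2"
      using second_eigenvalue_cut_bound[OF assms(1,2)] S True by blast
    ultimately show ?thesis using True by (simp add: field_simps)
  next
    case False
    hence "2 * ?t / ?k\<^sup>2 \<le> 0" by (auto simp: divide_le_0_iff not_less)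
    also have "0 \<le> ?ratio S" by simp
    finally show ?thesis .
  qed
  have "2 * ?t / ?k\<^sup>2 \<le> Min (?ratio ` ?sets)"
  proof (rule Min.boundedI)
    fix r assume "r \<in> ?ratio ` ?sets"
    then obtain S where "r = ?ratio S" "S \<in> ?sets" by (rule imageE)
    thus "2 * ?t / ?k\<^sup>2 \<le> r" using ratio by simp
  qed (use fin ne in simp_all)
  thus ?thesis by (simp only: isoperimetric_number_def setcompr_eq_image)
qed

end
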